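(* Let $\mathcal{P}$ be a mobile tree poset, let $\mathcal{Z}$ be an underlying ribbon of $\mathcal{P}$ of maximal cardinality, and assume $\mathcal{P}$ is free-standing with respect to $\mathcal{Z}$. Write the elements of $\mathcal{Z}$ as $z_1,\dots,z_k$ so that $z_i,z_j$ are related by a cover relation if and only if $|i-j|=1$. For $m\ge k$ let $\mathcal{P}_{\mathcal{Z},m}$ be the poset on $\mathcal{P}\sqcup\{z_{k+1},\dots,z_m\}$ with the cover relations of $\mathcal{P}$ together with $z_k\lessdot z_{k+1}\lessdot\cdots\lessdot z_m$, and let $N=\#\mathcal{P}_{\mathcal{Z},m}$. Then there is a polynomial $p\in\mathbb{Q}[N]$ with $e(\mathcal{P}_{\mathcal{Z},m})=p(N)$ for all $m\ge k$. If $\mathcal{Z}$ has at least one descent (an index $i$ with $z_{i+1}\lessdot z_i$), let $i$ be the largest such index and let $\mathcal{P}'$ be the connected component containing $z_1,\dots,z_i$ of the poset $\mathcal{P}_{\mathcal{Z},m}\ominus\{(z_{i+1},z_i)\}$; then $\deg p=\#\mathcal{P}'$. If $\mathcal{Z}$ has no descents, then $\deg p=0$.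
   Context: $e(\cdot)$ is the number of linear extensions. $x\lessdot y$ means $y$ covers $x$; $\mathcal{P}\ominus\{(x,y)\}$ is the poset on the same set whose order is generated by all cover relations except $x\lessdot y$. Ribbons: a ribbon is a poset whose Hasse diagram is a path $z_1 - z_2-\cdots - z_\ell$ (each consecutive pair related by a cover relation in either direction). Mobile tree posets: posets obtained from a ribbon $\mathcal{Z}$ by (i) for each $z\in\mathcal{Z}$ attaching $m_z\ge0$ pairwise disjoint rooted tree posets (tree Hasse diagram, unique maximal element) by making $z$ cover each of their roots; (ii) for at most one $z'\in\mathcal{Z}$, attaching a further disjoint rooted tree poset $\mathcal{Q}$ by adding $z'\lessdot q$ for some $q\in\mathcal{Q}$; taking transitive closures. $\mathcal{Z}$ is called an underlying ribbon; the mobile is free-standing with respect to $\mathcal{Z}$ if step (ii) is not used. *)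

theory Defs
  imports Complex_Main "HOL-Computational_Algebra.Polynomial"
begin

text \<open>A poset is given by its carrier \<open>A\<close> and its reflexive order relation \<open>r\<close>, with
  \<open>partial_order_on A r\<close>; \<open>(x, y) \<in> r\<close> means \<open>x \<le> y\<close>.\<close>

definition linear_extensions :: "'a set \<Rightarrow> 'a rel \<Rightarrow> 'a rel set" where
  "linear_extensions A r = {L. linear_order_on A L \<and> r \<subseteq> L}"

definition num_linear_extensions :: "'a set \<Rightarrow> 'a rel \<Rightarrow> nat" where
  "num_linear_extensions A r = card (linear_extensions A r)"

text \<open>\<open>(x, y) \<in> cover_rel r\<close> means that \<open>y\<close> covers \<open>x\<close>.\<close>

definition cover_rel :: "'a rel \<Rightarrow> 'a rel" where
  "cover_rel r = {(x, y). (x, y) \<in> r \<and> x \<noteq> y \<and>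
     \<not> (\<exists>w. w \<noteq> x \<and> w \<noteq> y \<and> (x, w) \<in> r \<and> (w, y) \<in> r)}"

definition generated_order :: "'a set \<Rightarrow> 'a rel \<Rightarrow> 'a rel" where
  "generated_order A C = Id_on A \<union> C\<^sup>+"

definition remove_covers :: "'a set \<Rightarrow> 'a rel \<Rightarrow> 'a rel \<Rightarrow> 'a rel" where
  "remove_covers A r S = generated_order A (cover_rel r - S)"

definition poset_components :: "'a set \<Rightarrow> 'a rel \<Rightarrow> 'a set set" where
  "poset_components A r = A // (r \<union> r\<inverse>)\<^sup>*"

definition hasse_adj :: "'a rel \<Rightarrow> 'a \<Rightarrow> 'a \<Rightarrow> bool" where
  "hasse_adj r x y \<longleftrightarrow> (x, y) \<in> cover_rel r \<or> (y, x) \<in> cover_rel r"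

definition hasse_tree :: "'a set \<Rightarrow> 'a rel \<Rightarrow> bool" where
  "hasse_tree A r \<longleftrightarrow> A \<noteq> {} \<and>
     (\<forall>x\<in>A. \<forall>y\<in>A. (hasse_adj r)\<^sup>*\<^sup>* x y) \<and>
     \<not> (\<exists>cs. length cs \<ge> 3 \<and> distinct cs \<and> successively (hasse_adj r) cs \<and>
            hasse_adj r (last cs) (hd cs))"

definition maximal_elements :: "'a set \<Rightarrow> 'a rel \<Rightarrow> 'a set" where
  "maximal_elements A r = {x \<in> A. \<forall>y\<in>A. (x, y) \<in> r \<longrightarrow> y = x}"

text \<open>The third argument is the root.\<close>

definition rooted_tree_poset :: "'a set \<Rightarrow> 'a rel \<Rightarrow> 'a \<Rightarrow> bool" where
  "rooted_tree_poset B s t \<longleftrightarrow>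
     finite B \<and> partial_order_on B s \<and> hasse_tree B s \<and> maximal_elements B s = {t}"

definition ribbon_labelling :: "'a rel \<Rightarrow> 'a set \<Rightarrow> nat \<Rightarrow> (nat \<Rightarrow> 'a) \<Rightarrow> bool" where
  "ribbon_labelling r Z k z \<longleftrightarrow> bij_betw z {1..k} Z \<and>
     (\<forall>i\<in>{1..k}. \<forall>j\<in>{1..k}. hasse_adj r (z i) (z j) \<longleftrightarrow> \<bar>int i - int j\<bar> = 1)"

definition ribbon :: "'a set \<Rightarrow> 'a rel \<Rightarrow> bool" where
  "ribbon Z r \<longleftrightarrow> partial_order_on Z r \<and> (\<exists>k\<ge>1. \<exists>z. ribbon_labelling r Z k z)"

text \<open>\<open>free_standing Z A r\<close>: the poset \<open>(A, r)\<close> arises from a ribbon with carrier \<open>Z\<close> by hanging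
  finitely many pairwise disjoint rooted trees below elements of \<open>Z\<close>. They are attached one at a
  time; since \<open>z\<close> always ranges over the original ribbon \<open>Z\<close>, and each new tree is disjoint from
  everything built so far, this is the same as attaching them all at once.\<close>

inductive free_standing :: "'a set \<Rightarrow> 'a set \<Rightarrow> 'a rel \<Rightarrow> bool" for Z :: "'a set" where
  ribbon: "ribbon Z r \<Longrightarrow> free_standing Z Z r"
| attach_below:
    "\<lbrakk>free_standing Z A r; z \<in> Z; rooted_tree_poset B s t; A \<inter> B = {}\<rbrakk> \<Longrightarrow>
     free_standing Z (A \<union> B) (generated_order (A \<union> B) (r \<union> s \<union> {(t, z)}))"

text \<open>In the second disjunct one further rooted tree \<open>(B, s)\<close> is attached along \<open>z \<lessdot> q\<close>, where
  \<open>q\<close> is an arbitrary element of the tree and not necessarily its root.\<close>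

definition underlying_ribbon :: "'a set \<Rightarrow> 'a set \<Rightarrow> 'a rel \<Rightarrow> bool" where
  "underlying_ribbon Z A r \<longleftrightarrow> free_standing Z A r \<or>
     (\<exists>A' r' z B s t q. free_standing Z A' r' \<and> z \<in> Z \<and> rooted_tree_poset B s t \<and>
        A' \<inter> B = {} \<and> q \<in> B \<and>
        A = A' \<union> B \<and> r = generated_order (A' \<union> B) (r' \<union> s \<union> {(z, q)}))"

definition mobile_tree_poset :: "'a set \<Rightarrow> 'a rel \<Rightarrow> bool" where
  "mobile_tree_poset A r \<longleftrightarrow> (\<exists>Z. underlying_ribbon Z A r)"

definition descents :: "'a rel \<Rightarrow> nat \<Rightarrow> (nat \<Rightarrow> 'a) \<Rightarrow> nat set" where
  "descents r k z = {i \<in> {1..<k}. (z (i + 1), z i) \<in> cover_rel r}"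

text \<open>The elements of the original poset are tagged with \<open>Inl\<close>; for \<open>j > k\<close> the new element
  \<open>z\<^sub>j\<close> is \<open>Inr j\<close>.\<close>

definition ext_label :: "nat \<Rightarrow> (nat \<Rightarrow> 'a) \<Rightarrow> nat \<Rightarrow> 'a + nat" where
  "ext_label k z j = (if j \<le> k then Inl (z j) else Inr j)"

definition ext_carrier :: "'a set \<Rightarrow> nat \<Rightarrow> nat \<Rightarrow> ('a + nat) set" where
  "ext_carrier A k m = A <+> {k<..m}"

definition ext_order :: "'a set \<Rightarrow> 'a rel \<Rightarrow> nat \<Rightarrow> (nat \<Rightarrow> 'a) \<Rightarrow> nat \<Rightarrow> ('a + nat) rel" where
  "ext_order A r k z m = generated_order (ext_carrier A k m)
     (map_prod Inl Inl ` cover_rel r \<union>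
      {(ext_label k z j, ext_label k z (j + 1)) | j. k \<le> j \<and> j < m})"

end

theory Submission
  imports Defs
begin

text \<open>Let \<open>i\<close> be the last descent of the ribbon. The linear extensions in which the edge between
  \<open>z\<^sub>i\<close> and \<open>z\<^bsub>i+1\<^esub>\<close> is dropped split into those with this edge and those with it reversed.
  Dropping it separates \<open>P'\<close> from a tree with root \<open>z\<^sub>m\<close>, whose number of linear extensions does not
  depend on \<open>m\<close> because every new element is a new top; so the total is a positive constant times
  \<open>N choose card P'\<close>, a polynomial in \<open>N\<close> of degree \<open>card P'\<close>. Reversing it gives a poset with one
  descent fewer, whose last descent is at a smaller index, hence by induction a polynomial of
  strictly smaller degree.\<close>

text \<open>The obstacle is that reversing or deleting a ribbon edge changes the order, and each
  time the result would have to be recognised again as a poset of a suitable kind. Hence orders are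
  given up for the count: linear extensions become lists that respect a bare relation, which need be
  neither transitive nor acyclic. The induction then varies only the descent set \<open>D\<close>,
  over a fixed carrier and with fixed edges inside the hanging trees. Orders return only at the two
  ends, through the fact that linear extensions depend on generators alone, and through a map
  sending each hanging tree to its ribbon element. The constant is \<open>c\<close>, the number of
  linear extensions of \<open>P'\<close> times that of the part of the original poset beyond the
  last descent. It is positive because a linear extension of the whole poset restricts to both
  parts. The subtracted polynomial has at most the degree belonging to the preceding descent, whose
  component misses \<open>z i\<close>; it cannot cancel the leading term, which comes from
  \<open>c\<close> divided by the factorial of \<open>card P'\<close>.\<close>

text \<open>Pairs of \<open>E\<close> outside \<open>A \<times> A\<close> and on the diagonal impose no condition, so \<open>E\<close> need not be
  restricted when \<open>A\<close> is replaced by a subset.\<close>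

definition lin_lists :: "'a set \<Rightarrow> 'a rel \<Rightarrow> 'a list set" where
  "lin_lists A E = {xs. distinct xs \<and> set xs = A \<and> sorted_wrt (\<lambda>x y. (y, x) \<notin> E) xs}"

section \<open>Linear extensions as lists\<close>

fun list_order :: "'a list \<Rightarrow> 'a rel" where
  "list_order [] = {}"
| "list_order (x # xs) = {x} \<times> set (x # xs) \<union> list_order xs"

lemma list_order_subset: "list_order xs \<subseteq> set xs \<times> set xs"
  by (induction xs) auto

lemma linear_order_on_list_order:
  "distinct xs \<Longrightarrow> linear_order_on (set xs) (list_order xs)"
proof (induction xs)
  case (Cons x xs)
  have "list_order xs \<subseteq> set xs \<times> set xs" by (rule list_order_subset)
  moreover from Cons have "linear_order_on (set xs) (list_order xs)" "x \<notin> set xs" by auto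
  ultimately show ?case
    unfolding order_on_defs list_order.simps
    by (intro conjI)
       (auto simp: refl_on_def total_on_def intro!: transI antisymI dest: transD antisymD)
qed simp

text \<open>By totality, having no pair of \<open>E\<close> backwards means having all of them
  forwards; diagonal pairs are harmless because \<open>list_order\<close> is reflexive. Inclusions
  are the form in which order arguments apply.\<close>

lemma sorted_wrt_iff_list_order:
  "distinct xs \<Longrightarrow> sorted_wrt (\<lambda>x y. (y, x) \<notin> E) xs \<longleftrightarrow> E \<inter> (set xs \<times> set xs) \<subseteq> list_order xs"
proof (induction xs)
  case (Cons x xs)
  have "list_order xs \<subseteq> set xs \<times> set xs" by (rule list_order_subset)
  with Cons show ?case by auto
qed simp

text \<open>The head is the least element, so the heads agree by antisymmetry; deleting the pairs
  that start at it leaves the order of the tail.\<close>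

lemma list_order_inject:
  "\<lbrakk>distinct xs; distinct ys; set xs = set ys; list_order xs = list_order ys\<rbrakk> \<Longrightarrow> xs = ys"
proof (induction xs arbitrary: ys)
  case (Cons x xs)
  then obtain y ys' where ys: "ys = y # ys'" by (cases ys) auto
  have "(x, y) \<in> list_order (x # xs)" "(y, x) \<in> list_order ys"
    using Cons.prems ys by auto
  with Cons.prems(2,4) linear_order_on_list_order[of ys] have [simp]: "y = x"
    by (auto simp: order_on_defs dest: antisymD)
  have tl: "list_order zs = list_order (x # zs) \<inter> (- {x}) \<times> UNIV" if "x \<notin> set zs" for zs
    using that list_order_subset[of zs] by auto
  have "list_order xs = list_order ys'"
    using tl[of xs] tl[of ys'] Cons.prems ys by (metis distinct.simps(2) \<open>y = x\<close>)
  moreover have "set xs = set ys'" using Cons.prems ys by auto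
  ultimately show ?case using Cons ys by auto
qed simp

lemma partial_order_minimal:
  assumes "partial_order_on A r" "finite A" "B \<subseteq> A" "B \<noteq> {}"
  obtains m where "m \<in> B" "\<And>x. x \<in> B \<Longrightarrow> (x, m) \<in> r \<Longrightarrow> x = m"
proof -
  have "finite r"
    using assms partial_order_onD(4) finite_subset finite_cartesian_product by metis
  then have "wf (r - Id)" using assms(1) partial_order_on_well_order_on by blast
  moreover obtain b where "b \<in> B" using assms by auto
  ultimately show ?thesis using that by (elim wfE_min[of _ b B]) auto
qed

lemma lin_lists_nonempty:
  assumes r: "partial_order_on A r" "finite A"
  shows "lin_lists A r \<noteq> {}"
proof -
  \<comment> \<open>Topological sorting by stripping minimal elements. Only the set shrinks:
    \<open>r\<close> is not an order on \<open>B\<close>, but subsets of \<open>A\<close> still have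
    minimal elements for it.\<close>
  have "lin_lists B r \<noteq> {}" if "B \<subseteq> A" for B
    using finite_subset[OF that r(2)] that
  proof (induction B rule: finite_psubset_induct)
    case (psubset B)
    show ?case
    proof (cases "B = {}")
      case True
      then have "[] \<in> lin_lists B r" by (simp add: lin_lists_def)
      then show ?thesis by blast
    next
      case False
      with psubset.prems r obtain m where m: "m \<in> B" "\<And>x. x \<in> B \<Longrightarrow> (x, m) \<in> r \<Longrightarrow> x = m"
        using partial_order_minimal by metis
      with psubset.IH[of "B - {m}"] psubset.prems obtain xs where "xs \<in> lin_lists (B - {m}) r"
        by blast
      with m have "m # xs \<in> lin_lists B r" by (auto simp: lin_lists_def)
      then show ?thesis by blast
    qed
  qed
  then show ?thesis by blast
qed

lemma linear_order_subset_eq: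
  assumes "linear_order_on A L" "linear_order_on A M" "L \<subseteq> M"
  shows "L = M"
proof -
  have "(a, b) \<in> L" if "(a, b) \<in> M" for a b
  proof (cases "a = b")
    case True
    with that assms show ?thesis by (auto simp: order_on_defs refl_on_def)
  next
    case False
    with that assms have "(a, b) \<in> L \<or> (b, a) \<in> L"
      unfolding order_on_defs total_on_def by blast
    with that assms False show ?thesis by (auto simp: order_on_defs dest: antisymD)
  qed
  with assms(3) show ?thesis by auto
qed

text \<open>A linear order is reflexive and transitive, so it absorbs the closure of whatever it
  contains. This is why linear extensions can be counted from generators alone.\<close>

lemma generated_order_subset_iff:
  assumes "linear_order_on A L"
  shows "generated_order A E \<subseteq> L \<longleftrightarrow> E \<subseteq> L"
proof
  assume "E \<subseteq> L"
  then have "E\<^sup>+ \<subseteq> L"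
    using assms trancl_id[of L] trancl_mono[of _ E L] by (auto simp: order_on_defs)
  moreover have "Id_on A \<subseteq> L"
    using assms by (auto simp: order_on_defs refl_on_def)
  ultimately show "generated_order A E \<subseteq> L" by (auto simp: generated_order_def)
qed (auto simp: generated_order_def)

lemma num_linear_extensions_generated_order:
  assumes "finite A" "E \<subseteq> A \<times> A"
  shows "num_linear_extensions A (generated_order A E) = card (lin_lists A E)"
proof -
  have "bij_betw list_order (lin_lists A E) (linear_extensions A (generated_order A E))"
    unfolding bij_betw_def
  proof
    show "inj_on list_order (lin_lists A E)"
      by (auto simp: inj_on_def lin_lists_def intro: list_order_inject)
    show "list_order ` lin_lists A E = linear_extensions A (generated_order A E)"
    proof (intro equalityI subsetI)
      fix L assume "L \<in> list_order ` lin_lists A E"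
      then obtain xs where xs: "L = list_order xs" "xs \<in> lin_lists A E" by auto
      then have "linear_order_on A L" "E \<subseteq> L"
        using assms(2) linear_order_on_list_order[of xs] sorted_wrt_iff_list_order[of xs E]
        by (auto simp: lin_lists_def)
      then show "L \<in> linear_extensions A (generated_order A E)"
        by (simp add: linear_extensions_def generated_order_subset_iff)
    next
      fix L assume "L \<in> linear_extensions A (generated_order A E)"
      then have L: "linear_order_on A L" "E \<subseteq> L"
        by (auto simp: linear_extensions_def generated_order_subset_iff)
      \<comment> \<open>The preimage is found by sorting \<open>A\<close> along \<open>L\<close>
        itself: the order of that list contains \<open>L\<close>, and nested linear orders on one
        set coincide.\<close>
      then have "lin_lists A L \<noteq> {}"
        using lin_lists_nonempty assms(1) by (auto simp: linear_order_on_def)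
      then obtain xs where xs: "xs \<in> lin_lists A L" by blast
      then have "linear_order_on A (list_order xs)"
        using linear_order_on_list_order[of xs] by (auto simp: lin_lists_def)
      moreover have "L \<subseteq> list_order xs"
        using xs L(1) sorted_wrt_iff_list_order[of xs L] by (auto simp: lin_lists_def order_on_defs)
      ultimately have "L = list_order xs" using L(1) linear_order_subset_eq by blast
      moreover have "xs \<in> lin_lists A E"
        using xs L(2) by (auto simp: lin_lists_def elim: sorted_wrt_mono_rel[rotated])
      ultimately show "L \<in> list_order ` lin_lists A E" by blast
    qed
  qed
  then show ?thesis by (simp add: num_linear_extensions_def bij_betw_same_card)
qed

lemma finite_lin_lists: "finite A \<Longrightarrow> finite (lin_lists A E)"
proof (rule finite_subset)
  show "lin_lists A E \<subseteq> {xs. set xs \<subseteq> A \<and> length xs = card A}"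
    by (auto simp: lin_lists_def distinct_card)
qed (rule finite_lists_length_eq)

lemma lin_lists_cong:
  assumes "\<And>x y. x \<in> A \<Longrightarrow> y \<in> A \<Longrightarrow> x \<noteq> y \<Longrightarrow> (x, y) \<in> E \<longleftrightarrow> (x, y) \<in> F"
  shows "lin_lists A E = lin_lists A F"
proof -
  have "E \<inter> (A \<times> A) \<subseteq> list_order xs \<longleftrightarrow> F \<inter> (A \<times> A) \<subseteq> list_order xs"
    if "distinct xs" "set xs = A" for xs
    using linear_order_on_list_order[of xs] that assms
    unfolding order_on_defs refl_on_def by blast
  then show ?thesis
    by (auto simp: lin_lists_def sorted_wrt_iff_list_order)
qed

section \<open>Counting rules for lists that respect a relation\<close>

lemma filter_lin_lists:
  "xs \<in> lin_lists A E \<Longrightarrow> filter (\<lambda>x. x \<in> B) xs \<in> lin_lists (A \<inter> B) E"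
  by (auto simp: lin_lists_def sorted_wrt_filter)

text \<open>Every list puts exactly one of \<open>x\<close> and \<open>y\<close> first. An
  orientation that creates a cycle simply contributes 0.\<close>

lemma lin_lists_orient_edge:
  assumes "finite A" "x \<in> A" "y \<in> A" "x \<noteq> y"
  shows "card (lin_lists A (insert (x, y) E)) + card (lin_lists A (insert (y, x) E))
    = card (lin_lists A E)"
proof -
  have *: "xs \<in> lin_lists A F \<longleftrightarrow> distinct xs \<and> set xs = A \<and> F \<inter> (A \<times> A) \<subseteq> list_order xs" for xs F
    by (auto simp: lin_lists_def sorted_wrt_iff_list_order)
  have lin: "linear_order_on A (list_order xs)" if "xs \<in> lin_lists A F" for xs F
    using that linear_order_on_list_order[of xs] by (auto simp: lin_lists_def)
  have "lin_lists A E = lin_lists A (insert (x, y) E) \<union> lin_lists A (insert (y, x) E)"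
  proof (intro equalityI subsetI)
    fix xs assume xs: "xs \<in> lin_lists A E"
    with lin assms have "(x, y) \<in> list_order xs \<or> (y, x) \<in> list_order xs"
      unfolding order_on_defs total_on_def by blast
    with xs show "xs \<in> lin_lists A (insert (x, y) E) \<union> lin_lists A (insert (y, x) E)"
      by (auto simp: *)
  qed (auto simp: *)
  moreover have "lin_lists A (insert (x, y) E) \<inter> lin_lists A (insert (y, x) E) = {}"
  proof (intro equals0I)
    fix xs assume xs: "xs \<in> lin_lists A (insert (x, y) E) \<inter> lin_lists A (insert (y, x) E)"
    then have "(x, y) \<in> list_order xs" "(y, x) \<in> list_order xs" "linear_order_on A (list_order xs)"
      using assms lin by (auto simp: *)
    with assms show False by (auto simp: order_on_defs dest: antisymD)
  qed
  ultimately show ?thesis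
    using card_Un_disjoint finite_lin_lists[OF assms(1)] by metis
qed

lemma lin_lists_disjoint_Un:
  assumes "B \<inter> C = {}" "\<And>x y. (x, y) \<in> E \<Longrightarrow> x \<in> B \<Longrightarrow> y \<notin> C" "\<And>x y. (x, y) \<in> E \<Longrightarrow> x \<in> C \<Longrightarrow> y \<notin> B"
  shows "lin_lists (B \<union> C) E = (\<Union>(xs, ys) \<in> lin_lists B E \<times> lin_lists C E. shuffles xs ys)"
proof (intro equalityI subsetI)
  fix zs assume zs: "zs \<in> lin_lists (B \<union> C) E"
  have "filter (\<lambda>x. x \<notin> B) zs = filter (\<lambda>x. x \<in> C) zs"
    using zs assms(1) by (intro filter_cong) (auto simp: lin_lists_def)
  then have "zs \<in> shuffles (filter (\<lambda>x. x \<in> B) zs) (filter (\<lambda>x. x \<in> C) zs)"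
    using partition_in_shuffles[of zs "\<lambda>x. x \<in> B"] by simp
  moreover have "filter (\<lambda>x. x \<in> B) zs \<in> lin_lists B E"
    using filter_lin_lists[OF zs, of B] by (simp add: Int_absorb1)
  moreover have "filter (\<lambda>x. x \<in> C) zs \<in> lin_lists C E"
    using filter_lin_lists[OF zs, of C] by (simp add: Int_absorb1)
  ultimately show "zs \<in> (\<Union>(xs, ys) \<in> lin_lists B E \<times> lin_lists C E. shuffles xs ys)"
    by blast
next
  fix zs assume "zs \<in> (\<Union>(xs, ys) \<in> lin_lists B E \<times> lin_lists C E. shuffles xs ys)"
  then obtain xs ys where *: "xs \<in> lin_lists B E" "ys \<in> lin_lists C E" and sh: "zs \<in> shuffles xs ys"
    by auto
  \<comment> \<open>Generalised to lists with entries in \<open>B\<close> and \<open>C\<close>,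
    since the tails met in the induction no longer exhaust these sets.\<close>
  have "sorted_wrt (\<lambda>x y. (y, x) \<notin> E) zs"
    if "zs \<in> shuffles xs ys" "sorted_wrt (\<lambda>x y. (y, x) \<notin> E) xs" "sorted_wrt (\<lambda>x y. (y, x) \<notin> E) ys"
      "set xs \<subseteq> B" "set ys \<subseteq> C" for zs xs ys
    using that
  proof (induction zs arbitrary: xs ys)
    case (Cons z zs)
    from Cons.prems(1) consider xs' where "xs = z # xs'" "zs \<in> shuffles xs' ys"
      | ys' where "ys = z # ys'" "zs \<in> shuffles xs ys'"
      by (auto simp: Cons_in_shuffles_iff neq_Nil_conv)
    then show ?case
    proof cases
      case 1
      with Cons.IH[of xs' ys] Cons.prems assms show ?thesis using set_shuffles[of zs xs' ys] by auto
    next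
      case 2
      with Cons.IH[of xs ys'] Cons.prems assms show ?thesis using set_shuffles[of zs xs ys'] by auto
    qed
  qed simp
  with * sh assms(1) show "zs \<in> lin_lists (B \<union> C) E"
    by (auto simp: lin_lists_def set_shuffles intro: distinct_disjoint_shuffles)
qed

text \<open>With no constraint between \<open>B\<close> and \<open>C\<close> every interleaving is
  allowed. The binomial coefficient counts the interleavings of one fixed pair of lists.\<close>

lemma card_lin_lists_disjoint_Un:
  assumes "finite B" "finite C" "B \<inter> C = {}"
    and "\<And>x y. (x, y) \<in> E \<Longrightarrow> x \<in> B \<Longrightarrow> y \<notin> C" "\<And>x y. (x, y) \<in> E \<Longrightarrow> x \<in> C \<Longrightarrow> y \<notin> B"
  shows "card (lin_lists (B \<union> C) E)
    = (card (B \<union> C) choose card B) * (card (lin_lists B E) * card (lin_lists C E))"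
proof -
  let ?I = "lin_lists B E \<times> lin_lists C E"
  have "card (lin_lists (B \<union> C) E) = card (\<Union>p\<in>?I. case p of (xs, ys) \<Rightarrow> shuffles xs ys)"
    using lin_lists_disjoint_Un[OF assms(3,4,5)] by simp
  also have "\<dots> = (\<Sum>p\<in>?I. card (case p of (xs, ys) \<Rightarrow> shuffles xs ys))"
  proof (subst card_UN_disjoint)
    show "finite ?I" using assms by (simp add: finite_lin_lists)
    show "\<forall>p\<in>?I. finite (case p of (xs, ys) \<Rightarrow> shuffles xs ys)" by auto
    \<comment> \<open>Filtering recovers both lists from any of their shuffles, so different pairs
      have disjoint sets of shuffles.\<close>
    have "xs = filter (\<lambda>x. x \<in> B) zs \<and> ys = filter (\<lambda>x. x \<in> C) zs"
      if "(xs, ys) \<in> ?I" "zs \<in> shuffles xs ys" for xs ys zs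
    proof -
      have "set xs \<inter> set ys = {}" "set xs = B" "set ys = C"
        using that assms(3) by (auto simp: lin_lists_def)
      with filter_shuffles_disjoint1[of xs ys zs] filter_shuffles_disjoint2[of xs ys zs] that(2)
      show ?thesis by simp
    qed
    then show "\<forall>p\<in>?I. \<forall>q\<in>?I. p \<noteq> q \<longrightarrow>
        (case p of (xs, ys) \<Rightarrow> shuffles xs ys) \<inter> (case q of (xs, ys) \<Rightarrow> shuffles xs ys) = {}"
      by (simp add: disjoint_iff Ball_def split: prod.split) metis
  qed simp
  also have "\<dots> = (\<Sum>(xs, ys) \<in> ?I. card (B \<union> C) choose card B)"
  proof (intro sum.cong refl)
    fix p assume "p \<in> ?I"
    then obtain xs ys where p: "p = (xs, ys)" "distinct xs" "set xs = B" "distinct ys" "set ys = C"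
      by (auto simp: lin_lists_def)
    then have "length xs = card B" "length xs + length ys = card (B \<union> C)"
      using assms(1-3) card_Un_disjoint[of B C] by (auto simp flip: distinct_card)
    with p assms(3) show "card (case p of (xs, ys) \<Rightarrow> shuffles xs ys)
        = (case p of (xs, ys) \<Rightarrow> card (B \<union> C) choose card B)"
      by (simp add: card_disjoint_shuffles)
  qed
  finally show ?thesis by (simp add: case_prod_unfold card_cartesian_product)
qed

text \<open>Everything in \<open>A\<close> lies below \<open>y\<close>, hence below
  \<open>t\<close>, so \<open>t\<close> must come last. The paths have to stay in \<open>A\<close>,
  because only elements of the list can transmit constraints.\<close>

lemma card_lin_lists_insert_top:
  assumes "t \<notin> A" "y \<in> A" "(y, t) \<in> E" "\<And>a. a \<in> A \<Longrightarrow> (t, a) \<notin> E"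
    and "\<And>a. a \<in> A \<Longrightarrow> (a, y) \<in> (E \<inter> A \<times> A)\<^sup>*"
  shows "card (lin_lists (insert t A) E) = card (lin_lists A E)"
proof -
  have "lin_lists (insert t A) E = (\<lambda>xs. xs @ [t]) ` lin_lists A E"
  proof (intro equalityI subsetI)
    fix zs assume zs: "zs \<in> lin_lists (insert t A) E"
    then obtain us vs where uv: "zs = us @ t # vs"
      by (metis (mono_tags, lifting) insertI1 lin_lists_def mem_Collect_eq split_list)
    have A: "set us \<union> set vs = A"
      using zs assms(1) by (auto simp: uv lin_lists_def)
    \<comment> \<open>The entries after \<open>t\<close> form an up-set of \<open>A\<close>; if
      there were any, \<open>y\<close> would be among them, yet \<open>y\<close> has to precede
      \<open>t\<close>.\<close>
    have closed: "b \<in> set vs" if "(a, b) \<in> (E \<inter> A \<times> A)\<^sup>*" "a \<in> set vs" for a b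
      using that
    proof (induction rule: rtrancl_induct)
      case (step b c)
      with zs A show ?case by (auto simp: uv lin_lists_def sorted_wrt_append)
    qed simp
    have "y \<notin> set vs"
      using zs assms(3) by (auto simp: uv lin_lists_def sorted_wrt_append)
    with closed assms(5) A have "vs = []" by (cases vs) auto
    with zs A show "zs \<in> (\<lambda>xs. xs @ [t]) ` lin_lists A E"
      by (auto simp: uv lin_lists_def sorted_wrt_append)
  qed (use assms in \<open>auto simp: lin_lists_def sorted_wrt_append\<close>)
  then show ?thesis by (simp add: card_image inj_on_def)
qed

text \<open>The falling factorial with \<open>a\<close> linear factors, divided by the factorial of
  \<open>a\<close>; for \<open>n < a\<close> both sides vanish.\<close>

lemma binomial_poly:
  obtains b :: "rat poly"
  where "degree b = a" "\<And>n. of_nat (n choose a) = poly b (of_nat n)"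
proof
  let ?b = "smult (1 / fact a) (\<Prod>i\<in>{0..<a}. [:- of_nat i, 1:]) :: rat poly"
  show "degree ?b = a" by (simp add: degree_prod_eq_sum_degree)
  show "of_nat (n choose a) = poly ?b (of_nat n)" for n
    by (simp add: binomial_gbinomial gbinomial_prod_rev poly_prod)
qed

section \<open>The recursion over descents, on an abstract ribbon with fibres\<close>

text \<open>\<open>f\<close> sends an element to the index of the ribbon element it hangs below. The ribbon \<open>w\<close> is
  infinite, so that all the extended posets are initial segments of a single one.\<close>

locale indexed_ribbon =
  fixes U :: "'b set" and f :: "'b \<Rightarrow> nat" and w :: "nat \<Rightarrow> 'b" and E0 :: "'b rel" and k :: nat
  assumes finite_below: "finite {x \<in> U. f x \<le> m}"
    and index_pos: "x \<in> U \<Longrightarrow> 1 \<le> f x"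
    and ribbon_in: "1 \<le> j \<Longrightarrow> w j \<in> U"
    and index_ribbon: "1 \<le> j \<Longrightarrow> f (w j) = j"
    and fibre_above: "\<lbrakk>x \<in> U; k < f x\<rbrakk> \<Longrightarrow> x = w (f x)"
    and edge_in: "(x, y) \<in> E0 \<Longrightarrow> x \<in> U \<and> y \<in> U"
    and edge_index: "(x, y) \<in> E0 \<Longrightarrow> f x = f y"
    and path_to_ribbon: "x \<in> U \<Longrightarrow> (x, w (f x)) \<in> E0\<^sup>*"
begin

text \<open>Half-open, so that \<open>seg 0 i\<close> and \<open>seg i m\<close> tile
  \<open>seg 0 m\<close>. With \<open>i\<close> the last descent, the former is \<open>P'\<close>
  and the latter the tree with root \<open>w m\<close>.\<close>

definition seg :: "nat \<Rightarrow> nat \<Rightarrow> 'b set" where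
  "seg a b = {x \<in> U. a < f x \<and> f x \<le> b}"

text \<open>The descent set is a free parameter, so that reversing the ribbon edge at
  \<open>i\<close> is just passing to \<open>edges (D - {i})\<close> on the same carrier.\<close>

definition edges :: "nat set \<Rightarrow> 'b rel" where
  "edges D = E0 \<union> {(w j, w (j + 1)) | j. 1 \<le> j \<and> j \<notin> D} \<union> {(w (j + 1), w j) | j. 1 \<le> j \<and> j \<in> D}"

lemma edgesE:
  assumes "(x, y) \<in> edges D"
  obtains "(x, y) \<in> E0"
    | j where "1 \<le> j" "j \<notin> D" "x = w j" "y = w (j + 1)"
    | j where "1 \<le> j" "j \<in> D" "x = w (j + 1)" "y = w j"
  using assms unfolding edges_def by blast

lemma ascent_in_edges: "1 \<le> j \<Longrightarrow> j \<notin> D \<Longrightarrow> (w j, w (Suc j)) \<in> edges D"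
  unfolding edges_def by auto

lemma descent_in_edges: "1 \<le> j \<Longrightarrow> j \<in> D \<Longrightarrow> (w (Suc j), w j) \<in> edges D"
  unfolding edges_def by auto

lemma finite_seg: "finite (seg a b)"
  by (rule finite_subset[OF _ finite_below[of b]]) (auto simp: seg_def)

lemma ribbon_in_seg: "1 \<le> j \<Longrightarrow> w j \<in> seg a b \<longleftrightarrow> a < j \<and> j \<le> b"
  by (simp add: seg_def ribbon_in index_ribbon)

lemma ribbon_eq_iff: "1 \<le> i \<Longrightarrow> 1 \<le> j \<Longrightarrow> w i = w j \<longleftrightarrow> i = j"
  using index_ribbon by metis

text \<open>Beyond \<open>a\<close> the ribbon only ascends: an element climbs to the ribbon inside
  its own fibre and then follows the ribbon up to \<open>w b\<close>.\<close>

lemma path_in_seg: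
  assumes "x \<in> seg a b" "\<forall>j\<in>D. j \<le> a"
  shows "(x, w b) \<in> (edges D \<inter> seg a b \<times> seg a b)\<^sup>*"
proof -
  have *: "(x, y) \<in> (edges D \<inter> seg a b \<times> seg a b)\<^sup>* \<and> f y = f x" if "(x, y) \<in> E0\<^sup>*" for y
    using that
  proof (induction rule: rtrancl_induct)
    case (step y z)
    then have "(y, z) \<in> edges D \<inter> seg a b \<times> seg a b"
      using edge_in[of y z] edge_index[of y z] assms(1) by (auto simp: seg_def edges_def)
    with step edge_index[of y z] show ?case using rtrancl_into_rtrancl by metis
  qed simp
  have x: "a < f x" "f x \<le> b" "x \<in> U" using assms(1) by (auto simp: seg_def)
  from x(2) have "(w (f x), w b) \<in> (edges D \<inter> seg a b \<times> seg a b)\<^sup>*"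
  proof (induction rule: inc_induct)
    case (step j)
    with x assms(2) have "(w j, w (Suc j)) \<in> edges D \<inter> seg a b \<times> seg a b"
      by (auto simp: ribbon_in_seg intro!: ascent_in_edges)
    from this step.IH show ?case by (rule converse_rtrancl_into_rtrancl)
  qed simp
  with *[OF path_to_ribbon[OF x(3)]] show ?thesis by (blast intro: rtrancl_trans)
qed

text \<open>Fibres beyond \<open>k\<close> consist of a ribbon element alone, so each step adds a
  single new top. It serves both the part above the last descent and, with \<open>a = 0\<close>, the
  case without descents.\<close>

lemma card_lin_lists_ascending:
  assumes "a < k" "k \<le> m" "\<forall>j\<in>D. j \<le> a"
  shows "card (lin_lists (seg a m) (edges D)) = card (lin_lists (seg a k) (edges D))"
  using assms(2)
proof (induction rule: dec_induct)
  case (step m)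
  have am: "a < m" "1 \<le> m" using step assms(1) by auto
  have seg: "seg a (Suc m) = insert (w (Suc m)) (seg a m)"
  proof (intro equalityI subsetI)
    fix x assume "x \<in> seg a (Suc m)"
    then have x: "x \<in> U" "a < f x" "f x \<le> Suc m" by (auto simp: seg_def)
    show "x \<in> insert (w (Suc m)) (seg a m)"
    proof (cases "f x = Suc m")
      case True
      then have "x = w (Suc m)" using fibre_above[OF x(1)] step(1) by (metis le_imp_less_Suc)
      then show ?thesis by simp
    qed (use x in \<open>auto simp: seg_def\<close>)
  next
    fix x assume "x \<in> insert (w (Suc m)) (seg a m)"
    then show "x \<in> seg a (Suc m)"
      using am ribbon_in_seg[of "Suc m" a "Suc m"] by (auto simp: seg_def)
  qed
  have "card (lin_lists (insert (w (Suc m)) (seg a m)) (edges D))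
    = card (lin_lists (seg a m) (edges D))"
  proof (rule card_lin_lists_insert_top[where y = "w m"])
    show "w (Suc m) \<notin> seg a m" "w m \<in> seg a m" using am by (auto simp: ribbon_in_seg)
    show "(w m, w (Suc m)) \<in> edges D"
      using am assms(3) by (intro ascent_in_edges) auto
    show "(w (Suc m), x) \<notin> edges D" if "x \<in> seg a m" for x
    proof
      assume "(w (Suc m), x) \<in> edges D"
      moreover have fx: "f x \<le> m" "f (w (Suc m)) = Suc m"
        using that by (auto simp: seg_def index_ribbon)
      ultimately show False
      proof (cases rule: edgesE)
        case 1
        then show False using fx edge_index[of "w (Suc m)" x] by simp
      next
        case (2 j)
        then have "j = Suc m" using ribbon_eq_iff[of "Suc m" j] by simp
        with 2 show False using fx(1) index_ribbon[of "j + 1"] by simp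
      next
        case (3 j)
        then have "Suc m = j + 1" using ribbon_eq_iff[of "Suc m" "j + 1"] by simp
        then have "m = j" by simp
        then have "m \<in> D" using 3 by simp
        then show False using assms(3) am by (meson not_less)
      qed
    qed
    show "(x, w m) \<in> (edges D \<inter> seg a m \<times> seg a m)\<^sup>*" if "x \<in> seg a m" for x
      using that assms(3) by (rule path_in_seg)
  qed
  from this step.IH show ?case unfolding seg by (rule trans)
qed simp

lemma seg_split: "i \<le> m \<Longrightarrow> seg 0 m = seg 0 i \<union> seg i m"
  by (auto simp: seg_def)

text \<open>Each index contributes at least its ribbon element; this makes the degree drop strictly
  from one descent to the preceding one.\<close>

lemma card_seg_strict_mono:
  assumes "i < j"
  shows "card (seg 0 i) < card (seg 0 j)"
proof (rule psubset_card_mono)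
  have "w j \<in> seg 0 j - seg 0 i" using assms by (auto simp: ribbon_in_seg)
  with assms show "seg 0 i \<subset> seg 0 j" by (auto simp: seg_def)
qed (rule finite_seg)

text \<open>Edges of \<open>E0\<close> stay in one fibre, and the only ribbon edge between indices
  \<open>i\<close> and \<open>i + 1\<close> is the removed one, as \<open>i\<close> is a descent.
  This yields both the independence of the two parts and the boundary of \<open>P'\<close>.\<close>

lemma edges_diff_index:
  assumes "i \<in> D" "(x, y) \<in> edges D - {(w (i + 1), w i)}"
  shows "f x \<le> i \<longleftrightarrow> f y \<le> i"
proof -
  from assms(2) have "(x, y) \<in> edges D" by simp
  then show ?thesis
  proof (cases rule: edgesE)
    case 1
    then show ?thesis using edge_index by simp
  next
    case (2 j)
    then show ?thesis using assms(1) by (cases "j = i") (auto simp: index_ribbon)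
  next
    case (3 j)
    then show ?thesis using assms(2) by (cases "j = i") (auto simp: index_ribbon)
  qed
qed

text \<open>The last factor is stated for \<open>seg i k\<close> instead of \<open>seg i m\<close>,
  so that only the binomial coefficient depends on \<open>m\<close>.\<close>

lemma card_lin_lists_last_descent:
  assumes D: "D \<subseteq> {1..<k}" "D \<noteq> {}" and m: "k \<le> m"
  defines "i \<equiv> Max D"
  shows "card (lin_lists (seg 0 m) (edges D)) + card (lin_lists (seg 0 m) (edges (D - {i})))
    = (card (seg 0 m) choose card (seg 0 i)) *
      (card (lin_lists (seg 0 i) (edges D)) * card (lin_lists (seg i k) (edges D)))"
proof -
  have fin: "finite D" using D(1) finite_subset by blast
  have "i \<in> D" unfolding i_def using fin D(2) by (rule Max_in)
  moreover have "\<forall>j\<in>D. j \<le> i" using fin by (simp add: i_def)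
  ultimately have i: "i \<in> D" "1 \<le> i" "i < k" "\<forall>j\<in>D. j \<le> i" using D(1) by auto
  \<comment> \<open>The edges common to both orientations.\<close>
  define F where "F = edges D - {(w (i + 1), w i)}"
  have w: "w i \<in> seg 0 m" "w (i + 1) \<in> seg 0 m" "w i \<noteq> w (i + 1)"
    using i m by (auto simp: ribbon_in_seg ribbon_eq_iff)
  have edge_last: "(w (i + 1), w i) \<in> edges D" "(w i, w (i + 1)) \<in> edges (D - {i})"
    using i descent_in_edges[of i D] ascent_in_edges[of i "D - {i}"] by auto
  have D_eq: "edges D = insert (w (i + 1), w i) F"
    using edge_last by (auto simp: F_def)
  \<comment> \<open>Otherwise the pair taken out to form \<open>F\<close> would be missing when
    \<open>edges (D - {i})\<close> is rebuilt from \<open>F\<close>.\<close>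
  have "(w (i + 1), w i) \<notin> edges (D - {i})"
  proof
    assume "(w (i + 1), w i) \<in> edges (D - {i})"
    then show False
    proof (cases rule: edgesE)
      case 1
      then show False using edge_index[of "w (i + 1)" "w i"] i(2) by (simp add: index_ribbon)
    qed (use i(2) in \<open>auto simp: ribbon_eq_iff\<close>)
  qed
  moreover have "edges (D - {i}) - {(w i, w (i + 1))} \<subseteq> edges D"
    unfolding edges_def by blast
  moreover have "edges D - {(w (i + 1), w i)} \<subseteq> edges (D - {i})"
    unfolding edges_def by blast
  ultimately have D'_eq: "edges (D - {i}) = insert (w i, w (i + 1)) F"
    using edge_last unfolding F_def by blast
  have "card (lin_lists (seg 0 m) (edges D)) + card (lin_lists (seg 0 m) (edges (D - {i})))
    = card (lin_lists (seg 0 m) F)"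
    unfolding D_eq D'_eq using w by (intro lin_lists_orient_edge finite_seg) auto
  also have "\<dots> = (card (seg 0 m) choose card (seg 0 i)) *
      (card (lin_lists (seg 0 i) F) * card (lin_lists (seg i m) F))"
  proof -
    have im: "i \<le> m" using i m by simp
    show ?thesis
      unfolding seg_split[OF im]
    proof (rule card_lin_lists_disjoint_Un[OF finite_seg finite_seg])
      show "seg 0 i \<inter> seg i m = {}" by (auto simp: seg_def)
    next
      fix x y assume xy: "(x, y) \<in> F"
      show "x \<in> seg 0 i \<Longrightarrow> y \<notin> seg i m" "x \<in> seg i m \<Longrightarrow> y \<notin> seg 0 i"
        using edges_diff_index[OF i(1), of x y] xy by (auto simp: seg_def F_def)
    qed
  qed
  finally have split: "card (lin_lists (seg 0 m) (edges D)) + card (lin_lists (seg 0 m) (edges (D - {i})))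
    = (card (seg 0 m) choose card (seg 0 i)) *
      (card (lin_lists (seg 0 i) F) * card (lin_lists (seg i m) F))" .
  \<comment> \<open>The removed edge has one end in each part, so inside either part
    \<open>F\<close> and \<open>edges D\<close> impose the same constraints.\<close>
  have lower: "lin_lists (seg 0 i) F = lin_lists (seg 0 i) (edges D)"
  proof (rule lin_lists_cong)
    have "w (i + 1) \<notin> seg 0 i" by (simp add: ribbon_in_seg)
    then show "(x, y) \<in> F \<longleftrightarrow> (x, y) \<in> edges D" if "x \<in> seg 0 i" for x y
      using that by (auto simp: D_eq)
  qed
  have upper: "lin_lists (seg i m) F = lin_lists (seg i m) (edges D)"
  proof (rule lin_lists_cong)
    have "w i \<notin> seg i m" using i(2) by (simp add: ribbon_in_seg)
    then show "(x, y) \<in> F \<longleftrightarrow> (x, y) \<in> edges D" if "y \<in> seg i m" for x y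
      using that by (auto simp: D_eq)
  qed
  have "card (lin_lists (seg i m) (edges D)) = card (lin_lists (seg i k) (edges D))"
    using i(3) m i(4) by (rule card_lin_lists_ascending)
  with split show ?thesis by (simp only: lower upper)
qed

text \<open>The locale does not make \<open>E0\<close> acyclic, so there may be no linear extension
  and the leading coefficient may vanish; hence the condition on the exact degree. The induction
  needs only the upper bound, which holds in any case.\<close>

lemma card_lin_lists_poly:
  assumes "D \<subseteq> {1..<k}" "1 \<le> k"
  shows "\<exists>p :: rat poly.
    (\<forall>m\<ge>k. of_nat (card (lin_lists (seg 0 m) (edges D))) = poly p (of_nat (card (seg 0 m)))) \<and>
    (D = {} \<longrightarrow> degree p = 0) \<and>
    (D \<noteq> {} \<longrightarrow> degree p \<le> card (seg 0 (Max D)) \<and>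
      (lin_lists (seg 0 k) (edges D) \<noteq> {} \<longrightarrow> degree p = card (seg 0 (Max D))))"
proof -
  have "finite D" using assms(1) finite_subset by blast
  then show ?thesis using assms(1)
  proof (induction D rule: finite_psubset_induct)
    case (psubset D)
    show ?case
    proof (cases "D = {}")
      case True
      have "of_nat (card (lin_lists (seg 0 m) (edges {})))
          = poly [:of_nat (card (lin_lists (seg 0 k) (edges {}))) :: rat:] (of_nat (card (seg 0 m)))"
        if "k \<le> m" for m
        using card_lin_lists_ascending[of 0 m "{}"] that assms(2) by simp
      with True show ?thesis by (metis degree_pCons_0)
    next
      case False
      define i where "i = Max D"
      have "i \<in> D" unfolding i_def using psubset.hyps False by (rule Max_in)
      then have i: "i \<in> D" "1 \<le> i" "i < k" using psubset.prems by auto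
      from i psubset.IH[of "D - {i}"] psubset.prems obtain q :: "rat poly" where
        q: "\<forall>m\<ge>k. of_nat (card (lin_lists (seg 0 m) (edges (D - {i})))) = poly q (of_nat (card (seg 0 m)))"
        and q0: "D - {i} = {} \<longrightarrow> degree q = 0"
        and q1: "D - {i} \<noteq> {} \<longrightarrow> degree q \<le> card (seg 0 (Max (D - {i})))"
        by blast
      have deg_q: "degree q < card (seg 0 i)"
      proof (cases "D - {i} = {}")
        case True
        then show ?thesis using q0 card_seg_strict_mono[of 0 i] i by auto
      next
        case False
        then have "Max (D - {i}) \<in> D - {i}" using psubset.hyps by (intro Max_in) auto
        moreover from this have "Max (D - {i}) \<le> i" using psubset.hyps by (simp add: i_def)
        ultimately have "Max (D - {i}) < i" by (simp add: le_less)
        with False q1 show ?thesis using card_seg_strict_mono le_less_trans by blast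
      qed
      define c where
        "c = card (lin_lists (seg 0 i) (edges D)) * card (lin_lists (seg i k) (edges D))"
      obtain b :: "rat poly" where b: "degree b = card (seg 0 i)"
        "\<And>n. of_nat (n choose card (seg 0 i)) = poly b (of_nat n)"
        using binomial_poly by blast
      \<comment> \<open>The recursion solved for the count with descent set \<open>D\<close>;
        \<open>q\<close> is the polynomial for the reversed edge.\<close>
      define p where "p = smult (of_nat c) b - q"
      have "of_nat (card (lin_lists (seg 0 m) (edges D))) = poly p (of_nat (card (seg 0 m)))"
        if m: "k \<le> m" for m
      proof -
        have "of_nat (card (lin_lists (seg 0 m) (edges D))) + poly q (of_nat (card (seg 0 m)))
          = of_nat (card (lin_lists (seg 0 m) (edges D)) + card (lin_lists (seg 0 m) (edges (D - {i}))))"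
          using q m by simp
        also have "\<dots> = poly b (of_nat (card (seg 0 m))) * of_nat c"
          using card_lin_lists_last_descent[OF psubset.prems False m] b(2)
          by (simp add: i_def c_def)
        finally show ?thesis by (simp add: p_def algebra_simps)
      qed
      moreover have "degree p \<le> card (seg 0 i)"
        using b(1) deg_q unfolding p_def
        by (intro degree_diff_le) (auto intro: order_trans[OF degree_smult_le])
      moreover have "degree p = card (seg 0 i)" if "lin_lists (seg 0 k) (edges D) \<noteq> {}"
      proof -
        from that obtain xs where xs: "xs \<in> lin_lists (seg 0 k) (edges D)" by blast
        \<comment> \<open>Restricting one list for the whole segment gives lists for both parts, so
          both factors of \<open>c\<close> are nonzero.\<close>
        have "lin_lists B (edges D) \<noteq> {}" if "B \<subseteq> seg 0 k" for B
          using filter_lin_lists[OF xs, of B] that by (auto simp: Int_absorb1)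
        moreover have "seg 0 i \<subseteq> seg 0 k" "seg i k \<subseteq> seg 0 k" using i by (auto simp: seg_def)
        ultimately have "c \<noteq> 0"
          by (simp add: c_def card_eq_0_iff finite_lin_lists finite_seg)
        then have "degree (smult (of_nat c) b) = card (seg 0 i)" using b(1) by simp
        then show ?thesis
          using deg_q degree_add_eq_left[of "- q" "smult (of_nat c) b"] by (simp add: p_def)
      qed
      ultimately show ?thesis using False unfolding i_def by blast
    qed
  qed
qed

end

section \<open>Covers and generated orders\<close>

text \<open>Induction on the size of the interval: splitting at an inner point removes an endpoint
  from each half.\<close>

lemma cover_rel_rtrancl:
  assumes r: "partial_order_on A r" "finite A" and xy: "(x, y) \<in> r"
  shows "(x, y) \<in> (cover_rel r)\<^sup>*"
  using xy
proof (induction "card {v. (x, v) \<in> r \<and> (v, y) \<in> r}" arbitrary: x y rule: less_induct)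
  case less
  let ?I = "\<lambda>x y. {v. (x, v) \<in> r \<and> (v, y) \<in> r}"
  note po = partial_order_onD[OF r(1)]
  have fin: "finite (?I x y)" for x y
    using po(4) r(2) by (rule_tac finite_subset[of _ A]) auto
  have xy: "x \<in> ?I x y" "y \<in> ?I x y"
    using less.prems po(1,4) by (auto simp: refl_on_def)
  show ?case
  proof (cases "x = y \<or> (x, y) \<in> cover_rel r")
    case False
    with less.prems obtain v where v: "v \<noteq> x" "v \<noteq> y" "(x, v) \<in> r" "(v, y) \<in> r"
      by (auto simp: cover_rel_def)
    have "y \<notin> ?I x v" "x \<notin> ?I v y"
      using v po(3) by (auto dest: antisymD)
    moreover have "?I x v \<subseteq> ?I x y" "?I v y \<subseteq> ?I x y"
      using v po(2) by (auto dest: transD)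
    ultimately have "?I x v \<subset> ?I x y" "?I v y \<subset> ?I x y" using xy by blast+
    then have "card (?I x v) < card (?I x y)" "card (?I v y) < card (?I x y)"
      using fin by (auto intro: psubset_card_mono)
    then have "(x, v) \<in> (cover_rel r)\<^sup>*" "(v, y) \<in> (cover_rel r)\<^sup>*"
      using less.hyps v by auto
    then show ?thesis by (rule rtrancl_trans)
  qed auto
qed

text \<open>A relation that is acyclic and has no pair implied by a detour is a Hasse diagram: a
  related pair outside \<open>C\<close> has an intermediate point, namely the one before its last
  step.\<close>

lemma cover_rel_generated_order:
  assumes ac: "acyclic C"
    and red: "\<And>x y v. (x, y) \<in> C \<Longrightarrow> (x, v) \<in> C\<^sup>+ \<Longrightarrow> (v, y) \<in> C\<^sup>+ \<Longrightarrow> False"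
  shows "cover_rel (generated_order A C) = C"
proof (intro equalityI subrelI)
  fix x y assume "(x, y) \<in> cover_rel (generated_order A C)"
  then have xy: "(x, y) \<in> C\<^sup>+" and
    min: "\<And>v. v \<noteq> x \<Longrightarrow> v \<noteq> y \<Longrightarrow> (x, v) \<in> C\<^sup>+ \<Longrightarrow> (v, y) \<in> C\<^sup>+ \<Longrightarrow> False"
    by (auto simp: cover_rel_def generated_order_def)
  from xy show "(x, y) \<in> C"
  proof (cases rule: tranclE)
    case (step v)
    then have "v \<noteq> x" "v \<noteq> y" using ac by (auto simp: acyclic_def)
    with step min[of v] show ?thesis by auto
  qed
next
  fix x y assume xy: "(x, y) \<in> C"
  then have "x \<noteq> y" using ac by (auto simp: acyclic_def)
  with xy red show "(x, y) \<in> cover_rel (generated_order A C)"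
    by (auto simp: cover_rel_def generated_order_def)
qed

section \<open>Free-standing mobiles retract onto their ribbon\<close>

text \<open>As \<open>t\<close> is the greatest element of \<open>B\<close>, all of \<open>B\<close>
  goes below exactly the up-set of \<open>z\<close>. The closed form makes the covers of the new
  order accessible.\<close>

lemma generated_order_attach_below:
  assumes r: "partial_order_on A r" and s: "partial_order_on B s" and AB: "A \<inter> B = {}"
    and z: "z \<in> A" and t: "t \<in> B" "\<And>b. b \<in> B \<Longrightarrow> (b, t) \<in> s"
  shows "generated_order (A \<union> B) (r \<union> s \<union> {(t, z)}) = r \<union> s \<union> B \<times> {a. (z, a) \<in> r}"
    (is "generated_order _ ?C = ?R")
proof (intro equalityI)
  note r = partial_order_onD[OF r] and s = partial_order_onD[OF s]
  have "trans ?R"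
  proof (rule transI)
    fix a b c assume "(a, b) \<in> ?R" "(b, c) \<in> ?R"
    then show "(a, c) \<in> ?R"
      using r(2,4) s(2,4) AB by (auto dest: transD)
  qed
  moreover have "?C \<subseteq> ?R" using r(1) z t(1) by (auto simp: refl_on_def)
  ultimately have "?C\<^sup>+ \<subseteq> ?R" using trancl_mono[of _ ?C ?R] by (auto simp: trancl_id)
  moreover have "Id_on (A \<union> B) \<subseteq> ?R" using r(1) s(1) by (auto simp: refl_on_def)
  ultimately show "generated_order (A \<union> B) ?C \<subseteq> ?R" by (auto simp: generated_order_def)
  have "(b, a) \<in> ?C\<^sup>+" if "b \<in> B" "(z, a) \<in> r" for a b
  proof -
    have "(b, t) \<in> ?C" "(t, z) \<in> ?C" "(z, a) \<in> ?C" using that t by auto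
    then show ?thesis by (meson trancl.r_into_trancl trancl.trancl_into_trancl)
  qed
  then show "?R \<subseteq> generated_order (A \<union> B) ?C" by (auto simp: generated_order_def)
qed

text \<open>By finiteness some maximal element lies above \<open>b\<close>, found as a minimal
  element of the converse order; uniqueness makes it \<open>t\<close>.\<close>

lemma rooted_tree_poset_root:
  assumes "rooted_tree_poset B s t"
  shows "t \<in> B" "b \<in> B \<Longrightarrow> (b, t) \<in> s"
proof -
  have B: "finite B" "partial_order_on B s" and max: "maximal_elements B s = {t}"
    using assms by (auto simp: rooted_tree_poset_def)
  note s = partial_order_onD[OF B(2)]
  show "t \<in> B" using max by (auto simp: maximal_elements_def)
  assume b: "b \<in> B"
  let ?S = "{x \<in> B. (b, x) \<in> s}"
  have S: "partial_order_on B (s\<inverse>)" "?S \<subseteq> B" "?S \<noteq> {}"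
    using B(2) b s(1) by (auto simp: refl_on_def)
  obtain m where m: "m \<in> ?S" "\<And>x. x \<in> ?S \<Longrightarrow> (x, m) \<in> s\<inverse> \<Longrightarrow> x = m"
    using partial_order_minimal[OF S(1) B(1) S(2,3)] by blast
  have "m \<in> maximal_elements B s"
    using m s(2) by (auto simp: maximal_elements_def dest: transD)
  with max m(1) show "(b, t) \<in> s" by auto
qed

text \<open>\<open>g\<close> sends each hanging tree to the ribbon element it hangs below.\<close>

lemma free_standing_retraction:
  assumes "free_standing Z A r"
  shows "finite A \<and> Z \<subseteq> A \<and> Z \<noteq> {} \<and> partial_order_on A r \<and>
    (\<exists>g. (\<forall>x\<in>Z. g x = x) \<and> (\<forall>x\<in>A. g x \<in> Z \<and> (x, g x) \<in> r) \<and>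
      (\<forall>(x, y)\<in>cover_rel r. g x = g y \<or> x \<in> Z \<and> y \<in> Z))"
  using assms
proof induction
  case (ribbon r)
  then obtain k and z :: "nat \<Rightarrow> 'a" where po: "partial_order_on Z r" and k: "k \<ge> 1" "bij_betw z {1..k} Z"
    unfolding ribbon_def ribbon_labelling_def by blast
  then have "finite Z" "Z \<noteq> {}"
    using bij_betw_finite[OF k(2)] by (auto simp: bij_betw_def)
  moreover have "\<forall>(x, y)\<in>cover_rel r. x \<in> Z \<and> y \<in> Z"
    using partial_order_onD(4)[OF po] by (auto simp: cover_rel_def)
  moreover have "\<forall>x\<in>Z. (x, x) \<in> r"
    using partial_order_onD(1)[OF po] by (auto simp: refl_on_def)
  ultimately show ?case using po by (auto intro!: exI[of _ "\<lambda>x. x"])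
next
  case (attach_below A r z B s t)
  then obtain g where A: "finite A" "Z \<subseteq> A" "Z \<noteq> {}" "partial_order_on A r"
    and g: "\<And>x. x \<in> Z \<Longrightarrow> g x = x" "\<And>x. x \<in> A \<Longrightarrow> g x \<in> Z \<and> (x, g x) \<in> r"
      "\<And>x y. (x, y) \<in> cover_rel r \<Longrightarrow> g x = g y \<or> x \<in> Z \<and> y \<in> Z"
    by blast
  have B: "finite B" "partial_order_on B s" using attach_below.hyps by (auto simp: rooted_tree_poset_def)
  note root = rooted_tree_poset_root[OF \<open>rooted_tree_poset B s t\<close>]
  note r = partial_order_onD[OF A(4)] and s = partial_order_onD[OF B(2)] and AB = \<open>A \<inter> B = {}\<close>
  define R where "R = r \<union> s \<union> B \<times> {a. (z, a) \<in> r}"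
  have z: "z \<in> A" "z \<notin> B" using A(2) \<open>z \<in> Z\<close> AB by auto
  have R: "generated_order (A \<union> B) (r \<union> s \<union> {(t, z)}) = R"
    unfolding R_def using generated_order_attach_below[OF A(4) B(2) AB z(1)] root by blast
  have "R \<subseteq> (A \<union> B) \<times> (A \<union> B)" using r(4) s(4) by (auto simp: R_def)
  moreover have "refl_on (A \<union> B) R" using r(1) s(1) by (auto simp: R_def refl_on_def)
  moreover have "trans R"
  proof (rule transI)
    fix a b c assume "(a, b) \<in> R" "(b, c) \<in> R"
    then show "(a, c) \<in> R"
      using r(2,4) s(2,4) AB by (auto simp: R_def dest: transD)
  qed
  moreover have "antisym R"
  proof (rule antisymI)
    fix a b assume "(a, b) \<in> R" "(b, a) \<in> R"
    then show "a = b"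
      using r(3,4) s(3,4) AB by (auto simp: R_def dest: antisymD)
  qed
  ultimately have po: "partial_order_on (A \<union> B) R" by (simp add: order_on_defs)
  define h where "h x = (if x \<in> A then g x else z)" for x
  have h_cover: "h x = h y \<or> x \<in> Z \<and> y \<in> Z" if xy: "(x, y) \<in> cover_rel R" for x y
  proof -
    have xyR: "(x, y) \<in> R" "x \<noteq> y" and min: "\<And>v. v \<noteq> x \<Longrightarrow> v \<noteq> y \<Longrightarrow> (x, v) \<in> R \<Longrightarrow> (v, y) \<in> R \<Longrightarrow> False"
      using xy by (auto simp: cover_rel_def)
    consider "(x, y) \<in> r" | "(x, y) \<in> s" | "x \<in> B" "(z, y) \<in> r" using xyR(1) by (auto simp: R_def)
    then show ?thesis
    proof cases
      case 1
      then have "(x, y) \<in> cover_rel r" using xyR(2) min by (auto simp: cover_rel_def R_def)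
      with 1 g(3) r(4) show ?thesis by (auto simp: h_def)
    next
      case 2
      then show ?thesis using s(4) AB by (auto simp: h_def)
    next
      case 3
      \<comment> \<open>The element \<open>z\<close> lies between \<open>x\<close> and
        \<open>y\<close>, so a cover leaving the new tree can only end in \<open>z\<close>, where
        \<open>h\<close> sends the whole tree.\<close>
      have "(x, z) \<in> R" "(z, y) \<in> R" using 3 r(1) z by (auto simp: R_def refl_on_def)
      with min[of z] z(2) 3(1) have "z = y" by auto
      with 3 z AB g(1) \<open>z \<in> Z\<close> show ?thesis by (auto simp: h_def)
    qed
  qed
  have "(x, h x) \<in> R \<and> h x \<in> Z" if "x \<in> A \<union> B" for x
    using that g(2) \<open>z \<in> Z\<close> r(1) z(1) by (auto simp: h_def R_def refl_on_def)
  moreover have "h x = x" if "x \<in> Z" for x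
    using that A(2) g(1) by (auto simp: h_def)
  ultimately have "\<exists>g. (\<forall>x\<in>Z. g x = x) \<and> (\<forall>x\<in>A \<union> B. g x \<in> Z \<and> (x, g x) \<in> R) \<and>
      (\<forall>(x, y)\<in>cover_rel R. g x = g y \<or> x \<in> Z \<and> y \<in> Z)"
    using h_cover by (intro exI[of _ h]) auto
  with A B(1) po show ?case unfolding R by auto
qed

section \<open>Covers of the extended poset\<close>

definition ext_covers :: "'a rel \<Rightarrow> nat \<Rightarrow> (nat \<Rightarrow> 'a) \<Rightarrow> nat \<Rightarrow> ('a + nat) rel" where
  "ext_covers r k z m = map_prod Inl Inl ` cover_rel r \<union>
      {(ext_label k z j, ext_label k z (j + 1)) | j. k \<le> j \<and> j < m}"

lemma ext_coversE:
  assumes "(u, v) \<in> ext_covers r k z m"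
  obtains x y where "u = Inl x" "v = Inl y" "(x, y) \<in> cover_rel r"
    | "u = Inl (z k)" "v = Inr (Suc k)" "k < m"
    | j where "u = Inr j" "v = Inr (Suc j)" "k < j" "j < m"
proof -
  consider "(u, v) \<in> map_prod Inl Inl ` cover_rel r"
    | j where "k \<le> j" "j < m" "u = ext_label k z j" "v = ext_label k z (j + 1)"
    using assms unfolding ext_covers_def by blast
  then show ?thesis
  proof cases
    case (2 j)
    then show ?thesis using that(2,3) by (cases "j = k") (auto simp: ext_label_def)
  qed (use that(1) in auto)
qed

text \<open>Only necessary conditions for being strictly below are stated; they suffice to exclude
  cycles and redundant generators.\<close>

lemma trancl_ext_covers:
  assumes r: "partial_order_on A r" and zk: "z k \<in> A" and uv: "(u, v) \<in> (ext_covers r k z m)\<^sup>+"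
  shows "case u of
      Inl x \<Rightarrow> (case v of Inl y \<Rightarrow> (x, y) \<in> r \<and> x \<noteq> y | Inr j \<Rightarrow> k < j \<and> (x, z k) \<in> r)
    | Inr i \<Rightarrow> (case v of Inl y \<Rightarrow> False | Inr j \<Rightarrow> i < j)"
  using uv
proof (induction rule: trancl_induct)
  note r = partial_order_onD[OF r]
  have refl: "(z k, z k) \<in> r" using r(1) zk by (auto simp: refl_on_def)
  {
    case (base v)
    then show ?case using refl by (cases rule: ext_coversE) (auto simp: cover_rel_def)
  next
    case (step v v')
    from step.hyps(2) show ?case
    proof (cases rule: ext_coversE)
      case (1 x y)
      with step.IH r(2,3) show ?thesis
        by (auto simp: cover_rel_def split: sum.splits dest: transD antisymD)
    qed (use step.IH in \<open>auto split: sum.splits\<close>)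
  }
qed

text \<open>Needed because \<open>remove_covers\<close> acts on the actual covers of the extended
  order, not on the relation that generated it.\<close>

lemma cover_rel_ext_order:
  assumes r: "partial_order_on A r" and zk: "z k \<in> A"
  shows "cover_rel (ext_order A r k z m) = ext_covers r k z m"
proof -
  note tr = trancl_ext_covers[where z = z, OF assms]
  have "cover_rel (generated_order (ext_carrier A k m) (ext_covers r k z m)) = ext_covers r k z m"
  proof (rule cover_rel_generated_order)
    show "acyclic (ext_covers r k z m)"
    proof (intro acyclicI allI notI)
      fix u assume "(u, u) \<in> (ext_covers r k z m)\<^sup>+"
      from tr[OF this] show False by (cases u) auto
    qed
  next
    fix u v t assume uv: "(u, v) \<in> ext_covers r k z m"
      and ut: "(u, t) \<in> (ext_covers r k z m)\<^sup>+" and tv: "(t, v) \<in> (ext_covers r k z m)\<^sup>+"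
    note * = tr[OF ut] tr[OF tv]
    from uv show False
    proof (cases rule: ext_coversE)
      case (1 x y)
      with * show ?thesis by (auto simp: cover_rel_def split: sum.splits)
    next
      \<comment> \<open>A point between \<open>z k\<close> and the first new element would be an old
        one both strictly above and below \<open>z k\<close>, or a new one with index strictly
        between \<open>k\<close> and \<open>Suc k\<close>.\<close>
      case 2
      with * show ?thesis using partial_order_onD(3)[OF r]
        by (auto split: sum.splits dest: antisymD)
    next
      case (3 j)
      with * show ?thesis by (auto split: sum.splits)
    qed
  qed
  then show ?thesis by (simp add: ext_order_def ext_covers_def)
qed

section \<open>A mobile as a ribbon with fibres\<close>

text \<open>What is kept of the inductive construction: \<open>idx\<close> numbers the ribbon
  element that an element hangs below, and a cover between different fibres joins two ribbon
  elements.\<close>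

locale labelled_mobile =
  fixes A :: "'a set" and r :: "'a rel" and k :: nat and z :: "nat \<Rightarrow> 'a" and idx :: "'a \<Rightarrow> nat"
  assumes fin: "finite A" and po: "partial_order_on A r" and k_pos: "1 \<le> k"
    and label_in: "j \<in> {1..k} \<Longrightarrow> z j \<in> A"
    and idx_label: "j \<in> {1..k} \<Longrightarrow> idx (z j) = j"
    and idx_in: "x \<in> A \<Longrightarrow> idx x \<in> {1..k}"
    and below_label: "x \<in> A \<Longrightarrow> (x, z (idx x)) \<in> r"
    and cover_idx: "(x, y) \<in> cover_rel r \<Longrightarrow> idx x = idx y \<or> x \<in> z ` {1..k} \<and> y \<in> z ` {1..k}"
    and label_adj: "\<lbrakk>i \<in> {1..k}; j \<in> {1..k}\<rbrakk> \<Longrightarrow> hasse_adj r (z i) (z j) \<longleftrightarrow> \<bar>int i - int j\<bar> = 1"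
begin

abbreviation D :: "nat set" where
  "D \<equiv> descents r k z"

text \<open>These take the place of \<open>E0\<close>: the covers whose direction never
  changes.\<close>

definition fibre_covers :: "'a rel" where
  "fibre_covers = {(x, y) \<in> cover_rel r. idx x = idx y}"

lemma cover_in: "(x, y) \<in> cover_rel r \<Longrightarrow> x \<in> A \<and> y \<in> A"
  using partial_order_onD(4)[OF po] by (auto simp: cover_rel_def)

lemma cover_asym: "(x, y) \<in> cover_rel r \<Longrightarrow> (y, x) \<notin> cover_rel r"
  using partial_order_onD(3)[OF po] by (auto simp: cover_rel_def dest: antisymD)

lemma descents_subset: "D \<subseteq> {1..<k}"
  by (auto simp: descents_def)

lemma ascent_cover:
  assumes "1 \<le> j" "j < k" "j \<notin> D"
  shows "(z j, z (Suc j)) \<in> cover_rel r"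
  using label_adj[of j "Suc j"] assms by (auto simp: hasse_adj_def descents_def)

lemma descent_cover: "j \<in> D \<Longrightarrow> (z (Suc j), z j) \<in> cover_rel r"
  by (simp add: descents_def)

lemma cover_cases:
  assumes "(x, y) \<in> cover_rel r"
  obtains "(x, y) \<in> fibre_covers"
    | j where "1 \<le> j" "j < k" "j \<notin> D" "x = z j" "y = z (Suc j)"
    | j where "1 \<le> j" "j \<in> D" "x = z (Suc j)" "y = z j"
proof (cases "idx x = idx y")
  case True
  then show ?thesis using assms that(1) by (simp add: fibre_covers_def)
next
  case False
  then obtain i j where ij: "i \<in> {1..k}" "j \<in> {1..k}" "x = z i" "y = z j"
    using cover_idx[OF assms] by blast
  then have "\<bar>int i - int j\<bar> = 1" using label_adj[of i j] assms by (simp add: hasse_adj_def)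
  then consider "j = Suc i" | "i = Suc j" by linarith
  then show ?thesis
  proof cases
    case 1
    then have "i \<notin> D" using cover_asym[OF assms] ij descent_cover by auto
    with 1 ij that(2) show ?thesis by auto
  next
    case 2
    then have "j \<in> D" using assms ij by (simp add: descents_def)
    with 2 ij that(3) show ?thesis by auto
  qed
qed

text \<open>A path of covers can leave a fibre only from a ribbon element, and that is already the
  label of its own index; so the induction from the end of the path can start afresh there.\<close>

lemma fibre_path:
  assumes "x \<in> A"
  shows "(x, z (idx x)) \<in> fibre_covers\<^sup>*"
proof -
  have "(x, z (idx x)) \<in> (cover_rel r)\<^sup>*"
    using cover_rel_rtrancl[OF po fin] below_label[OF assms] by blast
  then show ?thesis
  proof (induction rule: converse_rtrancl_induct)
    case base
    then show ?case using idx_label idx_in[OF assms] by simp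
  next
    case (step y y')
    show ?case
    proof (cases "idx y = idx y'")
      case True
      with step have "(y, y') \<in> fibre_covers" by (simp add: fibre_covers_def)
      with step.IH True show ?thesis by (simp add: converse_rtrancl_into_rtrancl)
    next
      case False
      then obtain i where "i \<in> {1..k}" "y = z i" using cover_idx step.hyps(1) by blast
      then show ?thesis by (simp add: idx_label)
    qed
  qed
qed

definition ext_idx :: "'a + nat \<Rightarrow> nat" where
  "ext_idx = case_sum idx (\<lambda>j. j)"

lemma ext_idx_simps [simp]: "ext_idx (Inl x) = idx x" "ext_idx (Inr j) = j"
  by (simp_all add: ext_idx_def)

sublocale indexed_ribbon "Inl ` A \<union> Inr ` {k<..}" ext_idx "ext_label k z"
  "map_prod Inl Inl ` fibre_covers" k
proof
  fix m
  have "{x \<in> Inl ` A \<union> Inr ` {k<..}. ext_idx x \<le> m} \<subseteq> Inl ` A \<union> Inr ` {..m}"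
    by (auto simp: ext_idx_def)
  then show "finite {x \<in> Inl ` A \<union> Inr ` {k<..}. ext_idx x \<le> m}"
    using fin finite_subset by blast
next
  fix x :: "'a + nat" assume "x \<in> Inl ` A \<union> Inr ` {k<..}"
  then show "1 \<le> ext_idx x" using idx_in by (fastforce simp: ext_idx_def)
next
  fix j :: nat assume "1 \<le> j"
  then show "ext_label k z j \<in> Inl ` A \<union> Inr ` {k<..}" "ext_idx (ext_label k z j) = j"
    by (auto simp: ext_label_def ext_idx_def idx_label intro!: label_in)
next
  fix x :: "'a + nat" assume "x \<in> Inl ` A \<union> Inr ` {k<..}" "k < ext_idx x"
  then show "x = ext_label k z (ext_idx x)"
    using idx_in by (fastforce simp: ext_idx_def ext_label_def)
next
  fix x y :: "'a + nat" assume "(x, y) \<in> map_prod Inl Inl ` fibre_covers"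
  then show "x \<in> Inl ` A \<union> Inr ` {k<..} \<and> y \<in> Inl ` A \<union> Inr ` {k<..}" "ext_idx x = ext_idx y"
    by (auto simp: fibre_covers_def ext_idx_def dest: cover_in)
next
  fix x :: "'a + nat" assume x: "x \<in> Inl ` A \<union> Inr ` {k<..}"
  have path: "(Inl a, Inl b :: 'a + nat) \<in> (map_prod Inl Inl ` fibre_covers)\<^sup>*"
    if "(a, b) \<in> fibre_covers\<^sup>*" for a b
    using that
  proof (induction rule: rtrancl_induct)
    case (step b c)
    then have "(Inl b, Inl c :: 'a + nat) \<in> map_prod Inl Inl ` fibre_covers" by force
    with step.IH show ?case by (rule rtrancl_into_rtrancl)
  qed simp
  show "(x, ext_label k z (ext_idx x)) \<in> (map_prod Inl Inl ` fibre_covers)\<^sup>*"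
  proof (cases x)
    case (Inl a)
    with x have "a \<in> A" by auto
    with Inl path[OF fibre_path, of a] idx_in[of a] show ?thesis
      by (simp add: ext_label_def ext_idx_def)
  next
    case (Inr j)
    with x show ?thesis by (auto simp: ext_label_def ext_idx_def)
  qed
qed

lemma seg_eq_ext_carrier:
  assumes "k \<le> m"
  shows "seg 0 m = ext_carrier A k m"
proof -
  have "0 < idx x \<and> idx x \<le> m" if "x \<in> A" for x
    using idx_in[OF that] assms by auto
  then show ?thesis by (auto simp: seg_def ext_carrier_def)
qed

text \<open>All descents lie below \<open>k\<close>, so the infinite ribbon ascends from
  \<open>k\<close> on, as the added chain does; restricting to \<open>seg 0 m\<close> cuts this
  chain off at \<open>m\<close>.\<close>

lemma ext_covers_eq_edges:
  assumes m: "k \<le> m"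
  shows "ext_covers r k z m = edges D \<inter> (seg 0 m \<times> seg 0 m)"
proof (intro equalityI subrelI)
  fix u v assume "(u, v) \<in> ext_covers r k z m"
  then show "(u, v) \<in> edges D \<inter> (seg 0 m \<times> seg 0 m)"
  proof (cases rule: ext_coversE)
    case (1 x y)
    have "(u, v) \<in> edges D"
      using 1(3)
    proof (cases rule: cover_cases)
      case 1
      then show ?thesis using \<open>u = Inl x\<close> \<open>v = Inl y\<close> by (auto simp: edges_def)
    next
      case (2 j)
      then show ?thesis using ascent_in_edges[of j D] \<open>u = Inl x\<close> \<open>v = Inl y\<close>
        by (simp add: ext_label_def)
    next
      case (3 j)
      then have "Suc j \<le> k" using descents_subset by auto
      with 3 show ?thesis using descent_in_edges[of j D] \<open>u = Inl x\<close> \<open>v = Inl y\<close>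
        by (simp add: ext_label_def)
    qed
    with 1 cover_in[OF 1(3)] show ?thesis
      by (auto simp: seg_eq_ext_carrier[OF m] ext_carrier_def)
  next
    case 2
    have "k \<notin> D" using descents_subset by auto
    then have "(u, v) \<in> edges D"
      using ascent_in_edges[of k D] k_pos 2 by (simp add: ext_label_def)
    with 2 k_pos label_in[of k] show ?thesis
      by (auto simp: seg_eq_ext_carrier[OF m] ext_carrier_def)
  next
    case (3 j)
    then have "j \<notin> D" using descents_subset by auto
    then have "(u, v) \<in> edges D"
      using ascent_in_edges[of j D] 3 by (simp add: ext_label_def)
    with 3 show ?thesis
      by (auto simp: seg_eq_ext_carrier[OF m] ext_carrier_def)
  qed
next
  fix u v assume "(u, v) \<in> edges D \<inter> (seg 0 m \<times> seg 0 m)"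
  then have uv: "(u, v) \<in> edges D" "u \<in> seg 0 m" "v \<in> seg 0 m" by auto
  from uv(1) show "(u, v) \<in> ext_covers r k z m"
  proof (cases rule: edgesE)
    case 1
    then show ?thesis by (auto simp: ext_covers_def fibre_covers_def)
  next
    case (2 j)
    show ?thesis
    proof (cases "j < k")
      case True
      then show ?thesis
        using 2 ascent_cover[of j] by (force simp: ext_covers_def ext_label_def)
    next
      case False
      have "j < m" using uv(3) 2 ribbon_in_seg[of "j + 1" 0 m] by simp
      with False 2 show ?thesis unfolding ext_covers_def by auto
    qed
  next
    case (3 j)
    then have "Suc j \<le> k" using descents_subset by auto
    with 3 show ?thesis
      using descent_cover[of j] by (force simp: ext_covers_def ext_label_def)
  qed
qed

lemma num_linear_extensions_ext_order:
  assumes "k \<le> m"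
  shows "num_linear_extensions (ext_carrier A k m) (ext_order A r k z m)
    = card (lin_lists (seg 0 m) (edges D))"
proof -
  have "num_linear_extensions (seg 0 m) (generated_order (seg 0 m) (ext_covers r k z m))
    = card (lin_lists (seg 0 m) (ext_covers r k z m))"
    using ext_covers_eq_edges[OF assms] finite_seg
    by (intro num_linear_extensions_generated_order) auto
  also have "lin_lists (seg 0 m) (ext_covers r k z m) = lin_lists (seg 0 m) (edges D)"
    using ext_covers_eq_edges[OF assms] by (intro lin_lists_cong) auto
  finally show ?thesis
    by (simp add: seg_eq_ext_carrier[OF assms] ext_order_def ext_covers_def)
qed

text \<open>This provides the condition for the exact degree: for \<open>m = k\<close> nothing is
  added, and the original poset has a linear extension.\<close>

lemma lin_lists_edges_nonempty: "lin_lists (seg 0 k) (edges D) \<noteq> {}"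
proof -
  obtain xs where xs: "xs \<in> lin_lists A r" using lin_lists_nonempty[OF po fin] by blast
  have "map Inl xs \<in> lin_lists (Inl ` A) (ext_covers r k z k)"
    using xs unfolding lin_lists_def
    by (auto simp: distinct_map sorted_wrt_map cover_rel_def ext_covers_def
        elim!: sorted_wrt_mono_rel[rotated])
  moreover have "seg 0 k = Inl ` A"
    by (auto simp: seg_eq_ext_carrier ext_carrier_def)
  moreover have "lin_lists (seg 0 k) (ext_covers r k z k) = lin_lists (seg 0 k) (edges D)"
    using ext_covers_eq_edges[of k] by (intro lin_lists_cong) auto
  ultimately show ?thesis by auto
qed

text \<open>No remaining edge leaves \<open>seg 0 i\<close>, and every element of it is joined to
  the first ribbon element through its fibre and then along the ribbon.\<close>

lemma component_of_remove_descent: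
  assumes i: "i \<in> D" and m: "k \<le> m"
  shows "seg 0 i \<in> poset_components (ext_carrier A k m)
      (remove_covers (ext_carrier A k m) (ext_order A r k z m)
        {(ext_label k z (i + 1), ext_label k z i)})"
proof -
  let ?w = "ext_label k z"
  define G where "G = edges D \<inter> (seg 0 m \<times> seg 0 m) - {(?w (i + 1), ?w i)}"
  define R where "R = generated_order (seg 0 m) G"
  define S where "S = (R \<union> R\<inverse>)\<^sup>*"
  have ik: "1 \<le> i" "i < k" using i descents_subset by auto
  have G_index: "ext_idx u \<le> i \<longleftrightarrow> ext_idx v \<le> i" if "(u, v) \<in> G" for u v
    using edges_diff_index[OF i, of u v] that by (auto simp: G_def)
  have G_seg: "G \<subseteq> seg 0 m \<times> seg 0 m" by (auto simp: G_def)
  have G_S: "(u, v) \<in> S" "(v, u) \<in> S" if "(u, v) \<in> G" for u v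
    using that by (auto simp: S_def R_def generated_order_def)
  have "sym S" unfolding S_def by (intro sym_rtrancl sym_Un_converse)
  have "trans S" unfolding S_def by (rule trans_rtrancl)
  have "S `` {?w 1} = seg 0 i"
  proof (intro equalityI subsetI)
    fix v assume "v \<in> S `` {?w 1}"
    then have "(?w 1, v) \<in> (R \<union> R\<inverse>)\<^sup>*" by (simp add: S_def)
    then show "v \<in> seg 0 i"
    proof (induction rule: rtrancl_induct)
      case base
      then show ?case using ik ribbon_in_seg[of 1 0 i] by simp
    next
      case (step u v)
      have closed: "u \<in> seg 0 i \<longleftrightarrow> v \<in> seg 0 i" if "(u, v) \<in> G\<^sup>+" for u v
        using that
      proof (induction rule: trancl_induct)
        case (base v)
        then show ?case using G_index[of u v] G_seg by (auto simp: seg_def)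
      next
        case (step v v')
        then show ?case using G_index[of v v'] G_seg by (auto simp: seg_def)
      qed
      from step.hyps(2) consider "u = v" | "(u, v) \<in> G\<^sup>+" | "(v, u) \<in> G\<^sup>+"
        by (auto simp: R_def generated_order_def)
      then show ?case using step.IH closed by cases auto
    qed
  next
    fix v assume v: "v \<in> seg 0 i"
    \<comment> \<open>Components ignore directions, so ascents and descents before \<open>i\<close>
      connect equally well, and none of them is the removed edge.\<close>
    have ribbon: "(?w 1, ?w j) \<in> S" if "1 \<le> j" "j \<le> i" for j
      using that
    proof (induction j rule: dec_induct)
      case base
      show ?case by (simp add: S_def)
    next
      case (step j)
      then have j: "1 \<le> j" "j < i" by auto
      then have "?w j \<in> seg 0 m" "?w (Suc j) \<in> seg 0 m"
        using ik m by (auto simp: ribbon_in_seg)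
      moreover have "?w j \<noteq> ?w i" "?w (Suc j) \<noteq> ?w (i + 1)"
        using j ik ribbon_eq_iff[of j i] ribbon_eq_iff[of "Suc j" "i + 1"] by auto
      moreover have "?w j \<noteq> ?w (i + 1)"
        using j ik ribbon_eq_iff[of j "i + 1"] by auto
      moreover have "(?w j, ?w (Suc j)) \<in> edges D \<or> (?w (Suc j), ?w j) \<in> edges D"
        using j ascent_in_edges[of j D] descent_in_edges[of j D] by blast
      ultimately have "(?w j, ?w (Suc j)) \<in> G \<or> (?w (Suc j), ?w j) \<in> G"
        by (auto simp: G_def)
      then have "(?w j, ?w (Suc j)) \<in> S" using G_S by blast
      moreover have "(?w 1, ?w j) \<in> S" using step.IH j by simp
      ultimately show ?case using \<open>trans S\<close> by (auto dest: transD)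
    qed
    have vi: "v \<in> Inl ` A \<union> Inr ` {k<..}" "1 \<le> ext_idx v" "ext_idx v \<le> i"
      using v index_pos by (auto simp: seg_def)
    have "(v, ?w (ext_idx v)) \<in> S \<and> ?w (ext_idx v) \<in> seg 0 i"
      using path_to_ribbon[OF vi(1)]
    proof (induction rule: rtrancl_induct)
      case base
      show ?case using v by (simp add: S_def)
    next
      case (step u u')
      have *: "u' \<in> seg 0 i" using edge_in edge_index step by (auto simp: seg_def)
      moreover have "seg 0 i \<subseteq> seg 0 m" using ik m by (auto simp: seg_def)
      moreover have "(u, u') \<noteq> (?w (i + 1), ?w i)"
        using edge_index[OF step.hyps(2)] ik index_ribbon[of i] index_ribbon[of "i + 1"] by auto
      ultimately have "(u, u') \<in> G" using step by (auto simp: G_def edges_def)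
      then have "(u, u') \<in> S" by (rule G_S)
      with step.IH * \<open>trans S\<close> show ?case by (auto dest: transD)
    qed
    then have "(?w (ext_idx v), v) \<in> S" using \<open>sym S\<close> by (auto dest: symD)
    with ribbon[OF vi(2,3)] \<open>trans S\<close> show "v \<in> S `` {?w 1}" by (auto dest: transD)
  qed
  moreover have "?w 1 \<in> seg 0 m" using k_pos m by (simp add: ribbon_in_seg)
  ultimately have "seg 0 i \<in> seg 0 m // S" by (auto simp: quotient_def)
  moreover have "remove_covers (ext_carrier A k m) (ext_order A r k z m) {(?w (i + 1), ?w i)} = R"
    using cover_rel_ext_order[OF po, of z k m] label_in[of k] k_pos
    by (simp add: remove_covers_def ext_covers_eq_edges[OF m] seg_eq_ext_carrier[OF m] R_def G_def)
  ultimately show ?thesis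
    by (simp add: poset_components_def S_def seg_eq_ext_carrier[OF m])
qed

end

theorem theorem6p5:
  fixes A Z :: "'a set" and r :: "'a rel" and k :: nat and z :: "nat \<Rightarrow> 'a"
  assumes "mobile_tree_poset A r"
    and "underlying_ribbon Z A r"
    and "\<And>Z'. underlying_ribbon Z' A r \<Longrightarrow> card Z' \<le> card Z"
    and "free_standing Z A r"
    and "ribbon_labelling r Z k z"
  shows "\<exists>p :: rat poly.
    (\<forall>m\<ge>k. of_nat (num_linear_extensions (ext_carrier A k m) (ext_order A r k z m))
             = poly p (of_nat (card (ext_carrier A k m)))) \<and>
    (descents r k z \<noteq> {} \<longrightarrow>
      (let i = Max (descents r k z) in
        \<forall>m\<ge>k. \<exists>P'. P' \<in> poset_components (ext_carrier A k m)
                   (remove_covers (ext_carrier A k m) (ext_order A r k z m)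
                     {(ext_label k z (i + 1), ext_label k z i)}) \<and>
               ext_label k z ` {1..i} \<subseteq> P' \<and>
               degree p = card P')) \<and>
    (descents r k z = {} \<longrightarrow> degree p = 0)"
proof -
  from free_standing_retraction[OF assms(4)] obtain g where
    A: "finite A" "Z \<subseteq> A" "Z \<noteq> {}" "partial_order_on A r"
    and g: "\<And>x. x \<in> Z \<Longrightarrow> g x = x" "\<And>x. x \<in> A \<Longrightarrow> g x \<in> Z" "\<And>x. x \<in> A \<Longrightarrow> (x, g x) \<in> r"
      "\<And>x y. (x, y) \<in> cover_rel r \<Longrightarrow> g x = g y \<or> x \<in> Z \<and> y \<in> Z"
    by blast
  have inj: "inj_on z {1..k}" and img: "z ` {1..k} = Z"
    and adj: "\<And>i j. i \<in> {1..k} \<Longrightarrow> j \<in> {1..k} \<Longrightarrow> hasse_adj r (z i) (z j) \<longleftrightarrow> \<bar>int i - int j\<bar> = 1"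
    using assms(5) by (auto simp: ribbon_labelling_def bij_betw_def)
  \<comment> \<open>The retraction onto the ribbon followed by the inverse of its labelling.\<close>
  define idx where "idx x = inv_into {1..k} z (g x)" for x
  interpret labelled_mobile A r k z idx
  proof
    show "1 \<le> k" using img A(3) by (cases k) auto
    show "z j \<in> A" if "j \<in> {1..k}" for j using that img A(2) by blast
    show "idx (z j) = j" if "j \<in> {1..k}" for j
    proof -
      have "z j \<in> Z" using that img by blast
      then show ?thesis using inv_into_f_f[OF inj that] by (simp add: idx_def g(1))
    qed
    show "idx x \<in> {1..k}" if "x \<in> A" for x
      unfolding idx_def by (rule inv_into_into) (use that g(2) img in blast)
    show "(x, z (idx x)) \<in> r" if "x \<in> A" for x
      using that g(2,3) img f_inv_into_f[of "g x" z "{1..k}"] by (simp add: idx_def)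
    show "idx x = idx y \<or> x \<in> z ` {1..k} \<and> y \<in> z ` {1..k}" if "(x, y) \<in> cover_rel r" for x y
      using g(4)[OF that] unfolding img by (auto simp: idx_def)
  qed (use A adj in auto)
  from card_lin_lists_poly[OF descents_subset k_pos] obtain p :: "rat poly" where
    p: "\<And>m. k \<le> m \<Longrightarrow> of_nat (card (lin_lists (seg 0 m) (edges D))) = poly p (of_nat (card (seg 0 m)))"
    and p0: "D = {} \<Longrightarrow> degree p = 0" and p1: "D \<noteq> {} \<Longrightarrow> degree p = card (seg 0 (Max D))"
    using lin_lists_edges_nonempty by blast
  have "seg 0 (Max D) \<in> poset_components (ext_carrier A k m)
      (remove_covers (ext_carrier A k m) (ext_order A r k z m)
        {(ext_label k z (Max D + 1), ext_label k z (Max D))})" if "D \<noteq> {}" "k \<le> m" for m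
    using component_of_remove_descent that Max_in[of D] finite_subset[OF descents_subset] by blast
  moreover have "ext_label k z ` {1..i} \<subseteq> seg 0 i" for i
    by (auto simp: ribbon_in_seg)
  moreover have "of_nat (num_linear_extensions (ext_carrier A k m) (ext_order A r k z m))
      = poly p (of_nat (card (ext_carrier A k m)))" if "k \<le> m" for m
    using p[OF that] num_linear_extensions_ext_order[OF that] seg_eq_ext_carrier[OF that] by simp
  ultimately show ?thesis
    using p0 p1 unfolding Let_def by (intro exI[of _ p]) blast
qed

end
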